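(* Let $g>0$, $H>0$, $U>0$, $P\ge1$, $\Delta x>0$. Let $\mathbf h(t),\mathbf u(t)\in\mathbb R^{P+1}$, $t\ge0$, be continuously differentiable solutions of the single-element semi-discrete scheme with left-boundary penalties $$\frac{d\mathbf h}{dt}+D_x(H\mathbf u+U\mathbf h)=\tau_0M_x^{-1}\mathbf e_L\mathbf e_L^\top(U\mathbf h)+\theta_0M_x^{-1}\mathbf e_L\mathbf e_L^\top(H\mathbf u),$$ $$\begin{aligned}\frac{d\mathbf u}{dt}&+D_x\left(g\mathbf h+U\mathbf u-\frac{H^2U}{3}D_x^2\mathbf u-\frac{H^2}{3}D_x\frac{d\mathbf u}{dt}\right)=\gamma_0M_x^{-1}D_x^\top\mathbf e_L\mathbf e_L^\top\left(H^2\frac{d\mathbf u}{dt}\right)+\sigma_0M_x^{-1}\mathbf e_L\mathbf e_L^\top M_x^{-1}\mathbf e_L\mathbf e_L^\top\left(H^2\frac{d\mathbf u}{dt}\right)\\&+\eta_0M_x^{-1}\mathbf e_L\mathbf e_L^\top(U\mathbf u)+\mu_0M_x^{-1}D_x^\top\mathbf e_L\mathbf e_L^\top(H^2UD_x\mathbf u)+\rho_0M_x^{-1}(D_x^\top)^2\mathbf e_L\mathbf e_L^\top(H^2U\mathbf u),\end{aligned}$$ with penalty parameters $\tau_0=\eta_0=-\frac12$, $\theta_0=-1$, $\rho_0=-\gamma_0=-\sigma_0=\frac13$, $\mu_0=-\frac16$. Define $$E_{M_x}(t)=\frac g2\|\mathbf h\|^2_{M_x}+\frac H2\|\mathbf u\|^2_{M_x}+\frac{H^3}{6}\|\widetilde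 D_x\mathbf u\|^2_{M_x},\qquad\widetilde D_x=D_x+M_x^{-1}\mathbf e_L\mathbf e_L^\top.$$ Considering only boundary contributions from the left boundary $x=x_L$ (see context), the discrete energy is conserved: $E_{M_x}(t)=E_{M_x}(0)$ for all $t\ge0$.
   Context: Operators: let $-1=\xi_1<\dots<\xi_{P+1}=1$ be the Gauss–Lobatto quadrature nodes on $[-1,1]$ with weights $\omega_i>0$ (exact for polynomials of degree $\le2P-1$), $\ell_j$ the Lagrange polynomials at these nodes, $M=\operatorname{diag}(\omega_1,\dots,\omega_{P+1})$, $Q_{ij}=\int_{-1}^1\ell_i\ell_j'\,d\xi=\sum_k\omega_k\ell_i(\xi_k)\ell_j'(\xi_k)$, $D=M^{-1}Q$, $D_x=\frac2{\Delta x}D$, $M_x=\frac{\Delta x}2M$, so that $M_xD_x+D_x^\top M_x=\operatorname{diag}(-1,0,\dots,0,1)$. The norm is $\|\mathbf u\|^2_{M_x}=\mathbf u^\top M_x\mathbf u$, and $\mathbf e_L=(1,0,\dots,0)^\top\in\mathbb R^{P+1}$. Node $1$ corresponds to the left boundary $x=x_L$, node $P+1$ to the right boundary. The scheme weakly imposes $h=u=\partial u/\partial x=0$ at $x_L$. "Considering only boundary contributions from the left boundary" means that the right-end contributions produced by summation by parts are absent, i.e. writing, entrywise, $$b=-gHhu-\frac{gU}{2}h^2-\frac{HU}{2}u^2+\frac{H^3U}{3}\left(u\,(D_x^2\mathbf u)-\frac12(D_x\mathbf u)^2\right)+\frac{H^3}{3}u\left(D_x\frac{d\mathbf u}{dt}\right),$$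 it is assumed that $b_{P+1}=0$ for all $t\ge0$. *)

theory Defs
  imports "HOL-Analysis.Analysis" "HOL-Computational_Algebra.Polynomial"
begin

text \<open>
  The nodes are indexed by a finite linearly ordered type \<open>'n\<close>. With \<open>P + 1\<close> nodes this means
  \<open>CARD('n) = P + 1\<close>; the indices \<open>1\<close> and \<open>P + 1\<close> are the least and the greatest element.
\<close>

text \<open>
  The notation \<open>real^'n\<close> forces the sort \<open>finite\<close> on \<open>'n\<close>; these synonyms leave the sort open.
\<close>

type_synonym 'n rvec = "(real, 'n) vec"
type_synonym 'n rmat = "((real, 'n) vec, 'n) vec"

definition left_ix :: "'n::{finite,linorder}" where
  "left_ix = Min UNIV"

definition right_ix :: "'n::{finite,linorder}" where
  "right_ix = Max UNIV"

text \<open>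
  Both endpoints are prescribed, so exactness up to degree \<open>2 * P - 1\<close> is the highest possible
  for \<open>P + 1\<close> nodes; it determines the nodes and the weights.
\<close>

definition gauss_lobatto :: "nat \<Rightarrow> ('n::{finite,linorder} \<Rightarrow> real) \<Rightarrow> ('n \<Rightarrow> real) \<Rightarrow> bool" where
  "gauss_lobatto P \<xi> \<omega> \<longleftrightarrow>
     CARD('n) = P + 1 \<and>
     strict_mono \<xi> \<and> \<xi> left_ix = - 1 \<and> \<xi> right_ix = 1 \<and>
     (\<forall>i. \<omega> i > 0) \<and>
     (\<forall>p :: real poly. degree p \<le> 2 * P - 1 \<longrightarrow>
        (\<Sum>i\<in>UNIV. \<omega> i * poly p (\<xi> i)) = integral {-1..1} (poly p))"

definition lagrange_poly :: "('n::finite \<Rightarrow> real) \<Rightarrow> 'n \<Rightarrow> real poly" where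
  "lagrange_poly \<xi> j = (\<Prod>k\<in>UNIV - {j}. smult (1 / (\<xi> j - \<xi> k)) [:- \<xi> k, 1:])"

definition mass_mat :: "('n::finite \<Rightarrow> real) \<Rightarrow> 'n rmat" where
  "mass_mat \<omega> = (\<chi> i j. if i = j then \<omega> i else 0)"

definition stiff_mat :: "('n::finite \<Rightarrow> real) \<Rightarrow> 'n rmat" where
  "stiff_mat \<xi> = (\<chi> i j. integral {-1..1}
     (\<lambda>x. poly (lagrange_poly \<xi> i) x * poly (pderiv (lagrange_poly \<xi> j)) x))"

definition diff_mat :: "('n::finite \<Rightarrow> real) \<Rightarrow> ('n \<Rightarrow> real) \<Rightarrow> 'n rmat" where
  "diff_mat \<xi> \<omega> = matrix_inv (mass_mat \<omega>) ** stiff_mat \<xi>"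

definition mass_mat_x :: "real \<Rightarrow> ('n::finite \<Rightarrow> real) \<Rightarrow> 'n rmat" where
  "mass_mat_x \<Delta>x \<omega> = (\<Delta>x / 2) *\<^sub>R mass_mat \<omega>"

definition diff_mat_x :: "real \<Rightarrow> ('n::finite \<Rightarrow> real) \<Rightarrow> ('n \<Rightarrow> real) \<Rightarrow> 'n rmat" where
  "diff_mat_x \<Delta>x \<xi> \<omega> = (2 / \<Delta>x) *\<^sub>R diff_mat \<xi> \<omega>"

definition outer :: "('n::finite) rvec \<Rightarrow> 'n rvec \<Rightarrow> 'n rmat" where
  "outer a b = (\<chi> i j. a $ i * b $ j)"

definition e_L :: "('n::{finite,linorder}) rvec" where
  "e_L = axis left_ix 1"

definition norm_sq :: "('n::finite) rmat \<Rightarrow> 'n rvec \<Rightarrow> real" where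
  "norm_sq M v = v \<bullet> (M *v v)"

definition energy ::
  "real \<Rightarrow> real \<Rightarrow> ('n::{finite,linorder}) rmat \<Rightarrow> 'n rmat \<Rightarrow> 'n rvec \<Rightarrow> 'n rvec \<Rightarrow> real" where
  "energy g H M D h u =
     g / 2 * norm_sq M h + H / 2 * norm_sq M u
     + H ^ 3 / 6 * norm_sq M ((D + matrix_inv M ** outer e_L e_L) *v u)"

text \<open>In \<open>boundary_term\<close> the argument \<open>u'\<close> stands for the time derivative of \<open>u\<close>.\<close>

definition boundary_term ::
  "real \<Rightarrow> real \<Rightarrow> real \<Rightarrow> ('n::finite) rmat \<Rightarrow> 'n rvec \<Rightarrow> 'n rvec \<Rightarrow> 'n rvec \<Rightarrow> 'n rvec" where
  "boundary_term g H U D h u u' = (\<chi> i.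
     - g * H * h $ i * u $ i - g * U / 2 * (h $ i)\<^sup>2 - H * U / 2 * (u $ i)\<^sup>2
     + H ^ 3 * U / 3 * (u $ i * ((D ** D) *v u) $ i - 1 / 2 * ((D *v u) $ i)\<^sup>2)
     + H ^ 3 / 3 * u $ i * (D *v u') $ i)"

end

theory Submission imports Defs begin

text \<open>
  By the fundamental theorem of calculus, \<open>stiff_mat \<xi>\<close> plus its transpose is the boundary
  matrix \<open>diag (- 1, 0, \<dots>, 0, 1)\<close>; this is summation by parts for \<open>D\<close> with respect to \<open>M\<close>.
  Test the two equations with \<open>g M h\<close> and \<open>H M u\<close> and sum by parts. The penalties cancel every
  term at the left node, the extra part of the modified norm cancelling the \<open>\<gamma>0\<close> and \<open>\<sigma>0\<close>
  penalties, so the derivative of the energy is the boundary term at the right node.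
\<close>

lemma outer_mult_vec: "outer a b *v x = (b \<bullet> x) *\<^sub>R a"
  by (simp add: vec_eq_iff outer_def matrix_vector_mult_def inner_vec_def sum_distrib_left
      ac_simps)

lemma inner_e_L [simp]: "e_L \<bullet> x = x $ left_ix" "x \<bullet> e_L = x $ left_ix"
  by (simp_all add: e_L_def inner_axis inner_axis')

lemma poly_lagrange_poly:
  assumes "inj \<xi>"
  shows "poly (lagrange_poly \<xi> i) (\<xi> j) = (if i = j then 1 else 0)"
proof (cases "i = j")
  case True
  have "(1 / (\<xi> j - \<xi> k)) * (\<xi> j - \<xi> k) = 1" if "k \<noteq> j" for k
    using assms that by (simp add: inj_eq)
  then show ?thesis
    using True by (simp add: lagrange_poly_def poly_prod right_diff_distrib)
next
  case False
  then show ?thesis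
    \<comment> \<open>The factor with index \<open>j\<close> is present because i and j differ, and
      it vanishes at \<open>\<xi> j\<close>.\<close>
    by (auto simp: lagrange_poly_def poly_prod intro!: prod_zero bexI[of _ j])
qed

text \<open>The two integrands add up to the derivative of the product of two Lagrange polynomials.
  Its integral is the difference of endpoint values, and both endpoints are nodes, so these are 0 or
  1.\<close>

lemma stiff_mat_add_transpose:
  assumes "inj \<xi>" "\<xi> l = - 1" "\<xi> r = 1"
  shows "stiff_mat \<xi> + transpose (stiff_mat \<xi>) = outer (axis r 1) (axis r 1) - outer (axis l 1) (axis l 1)"
proof -
  have "stiff_mat \<xi> $ i $ j + stiff_mat \<xi> $ j $ i
    = (if i = r \<and> j = r then 1 else 0) - (if i = l \<and> j = l then 1 else 0)" for i j
  proof -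
    let ?p = "lagrange_poly \<xi> i" and ?q = "lagrange_poly \<xi> j"
    have "((\<lambda>x. poly ?p x * poly (pderiv ?q) x + poly ?q x * poly (pderiv ?p) x) has_integral
        poly (?p * ?q) 1 - poly (?p * ?q) (- 1)) {- 1..1}"
    proof (rule fundamental_theorem_of_calculus)
      show "(poly (?p * ?q) has_vector_derivative
          poly ?p x * poly (pderiv ?q) x + poly ?q x * poly (pderiv ?p) x) (at x within {- 1..1})" for x
        using has_field_derivative_at_within[OF poly_DERIV[of "?p * ?q" x]]
        by (simp add: has_real_derivative_iff_has_vector_derivative pderiv_mult del: poly_mult)
          (simp add: mult.commute)
    qed simp
    moreover have "(\<lambda>x. poly a x * poly b x) integrable_on {- 1..1}" for a b :: "real poly"
      by (intro integrable_continuous_interval continuous_intros)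
    ultimately have "stiff_mat \<xi> $ i $ j + stiff_mat \<xi> $ j $ i
      = poly (?p * ?q) 1 - poly (?p * ?q) (- 1)"
      by (simp add: stiff_mat_def integral_add[symmetric] integral_unique)
    then show ?thesis
      using poly_lagrange_poly[OF assms(1), of _ l] poly_lagrange_poly[OF assms(1), of _ r] assms(2,3)
      by simp
  qed
  then show ?thesis
    by (auto simp: vec_eq_iff transpose_def outer_def axis_def)
qed

lemma transpose_mass_mat_x: "transpose (mass_mat_x d \<omega>) = mass_mat_x d \<omega>"
  by (auto simp: transpose_def mass_mat_x_def mass_mat_def vec_eq_iff)

lemma matrix_mult_matrix_inv:
  assumes "invertible A"
  shows "A ** matrix_inv A = mat 1"
  using someI_ex[OF assms[unfolded invertible_def]] by (simp add: matrix_inv_def)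

lemma mass_mat_inverse:
  assumes "\<forall>i. \<omega> i > 0"
  shows "mass_mat \<omega> ** mass_mat (\<lambda>i. 1 / \<omega> i) = mat 1"
    and "mass_mat (\<lambda>i. 1 / \<omega> i) ** mass_mat \<omega> = mat 1"
proof -
  have "\<omega> i \<noteq> 0" for i
    using assms by (metis less_irrefl)
  moreover have "(if b then x else 0) * y = (if b then x * y else 0)" for b and x y :: real
    by simp
  ultimately show "mass_mat \<omega> ** mass_mat (\<lambda>i. 1 / \<omega> i) = mat 1"
    and "mass_mat (\<lambda>i. 1 / \<omega> i) ** mass_mat \<omega> = mat 1"
    by (auto simp: mass_mat_def matrix_matrix_mult_def mat_def vec_eq_iff)
qed

text \<open>The element scalings d/2 and 2/d cancel, so summation by parts on the physical element
  is governed by the same matrix as on the reference element.\<close>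

lemma mass_mat_x_mult_diff_mat_x:
  assumes "\<forall>i. \<omega> i > 0" "d > 0"
  shows "mass_mat_x d \<omega> ** diff_mat_x d \<xi> \<omega> = stiff_mat \<xi>"
proof -
  have "mass_mat \<omega> ** matrix_inv (mass_mat \<omega>) = mat 1"
    using mass_mat_inverse[OF assms(1)] by (intro matrix_mult_matrix_inv) (auto simp: invertible_def)
  then have "mass_mat \<omega> ** diff_mat \<xi> \<omega> = stiff_mat \<xi>"
    by (simp add: diff_mat_def matrix_mul_assoc)
  then show ?thesis
    using assms(2) by (simp add: mass_mat_x_def diff_mat_x_def matrix_scalar_ac
        flip: scalar_matrix_assoc)
qed

lemma invertible_mass_mat_x:
  assumes "\<forall>i. \<omega> i > 0" "d > 0"
  shows "invertible (mass_mat_x d \<omega>)"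
  unfolding mass_mat_x_def
  using mass_mat_inverse[OF assms(1)] assms(2)
  by (intro scalar_invertible) (auto simp: invertible_def)

lemma inner_transpose_mult:
  fixes A :: "real^'n^'m"
  shows "x \<bullet> (transpose A *v y) = (A *v x) \<bullet> y"
  using dot_lmul_matrix[of x "transpose A" y] by simp

lemma inner_symmetric_matrix:
  fixes M :: "real^'n^'n"
  assumes "transpose M = M"
  shows "x \<bullet> (M *v y) = y \<bullet> (M *v x)"
  using inner_transpose_mult[of x M y] assms by (simp add: inner_commute)

text \<open>By symmetry of \<open>M\<close>, the second summand equals \<open>a\<close> tested
  against the transposed stiffness matrix applied to \<open>b\<close>. Only the stiffness matrix
  plus its transpose is left.\<close>

lemma summation_by_parts:
  fixes \<xi> \<omega> :: "'n::{finite,linorder} \<Rightarrow> real"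
  assumes "gauss_lobatto P \<xi> \<omega>" "d > 0"
  defines "M \<equiv> mass_mat_x d \<omega>" and "D \<equiv> diff_mat_x d \<xi> \<omega>"
  shows "a \<bullet> (M *v (D *v b)) + (D *v a) \<bullet> (M *v b)
    = a $ right_ix * b $ right_ix - a $ left_ix * b $ left_ix"
proof -
  let ?Q = "stiff_mat \<xi>"
  have pos: "\<forall>i. \<omega> i > 0" and inj: "inj \<xi>" and ends: "\<xi> left_ix = - 1" "\<xi> right_ix = 1"
    using assms(1) by (auto simp: gauss_lobatto_def strict_mono_imp_inj_on)
  have MD: "M *v (D *v x) = ?Q *v x" for x
    using mass_mat_x_mult_diff_mat_x[OF pos assms(2)]
    by (simp add: M_def D_def matrix_vector_mul_assoc)
  have "(D *v a) \<bullet> (M *v b) = a \<bullet> (transpose ?Q *v b)"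
    using inner_symmetric_matrix[of M "D *v a" b] MD[of a]
    by (simp add: M_def transpose_mass_mat_x inner_transpose_mult inner_commute
        del: transpose_matrix_vector)
  then have "a \<bullet> (M *v (D *v b)) + (D *v a) \<bullet> (M *v b) = a \<bullet> ((?Q + transpose ?Q) *v b)"
    by (simp add: MD matrix_vector_mult_add_rdistrib inner_add_right)
  also have "\<dots> = a $ right_ix * b $ right_ix - a $ left_ix * b $ left_ix"
    by (simp add: stiff_mat_add_transpose[OF inj ends] matrix_vector_mult_diff_rdistrib
        outer_mult_vec inner_diff_right inner_axis inner_axis' mult.commute)
  finally show ?thesis .
qed

text \<open>The two terms of the product rule agree because \<open>M\<close> is symmetric, hence the
  factor 2.\<close>

lemma norm_sq_has_real_derivative:
  assumes "transpose M = M" and "(x has_vector_derivative x') (at t within S)"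
  shows "((\<lambda>t. norm_sq M (x t)) has_real_derivative 2 * (x t \<bullet> (M *v x'))) (at t within S)"
proof -
  have "((\<lambda>t. M *v x t) has_vector_derivative M *v x') (at t within S)"
    by (intro bounded_linear.has_vector_derivative[OF _ assms(2)] matrix_vector_mul_bounded_linear)
  from bounded_bilinear.has_vector_derivative[OF bounded_bilinear_inner assms(2) this]
  show ?thesis
    by (simp add: norm_sq_def has_real_derivative_iff_has_vector_derivative
        inner_symmetric_matrix[OF assms(1), of x'] inner_commute[of "_ *v _"])
qed

text \<open>Pure algebra at one instant: \<open>h'\<close> and \<open>u'\<close> are plain vectors.
  When they are the time derivatives, the left-hand side is the derivative of the energy.\<close>

lemma energy_rate:
  fixes M D :: "('n::{finite,linorder}) rmat"
  assumes sym: "transpose M = M" and inv: "invertible M"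
    and sbp: "\<And>a b. a \<bullet> (M *v (D *v b)) + (D *v a) \<bullet> (M *v b)
      = a $ right_ix * b $ right_ix - a $ left_ix * b $ left_ix"
    and h: "h' + D *v (H *\<^sub>R u + U *\<^sub>R h)
      = (- 1 / 2) *\<^sub>R ((matrix_inv M ** outer e_L e_L) *v (U *\<^sub>R h))
        + (- 1) *\<^sub>R ((matrix_inv M ** outer e_L e_L) *v (H *\<^sub>R u))"
    and u: "u' + D *v (g *\<^sub>R h + U *\<^sub>R u
                   - (H\<^sup>2 * U / 3) *\<^sub>R ((D ** D) *v u) - (H\<^sup>2 / 3) *\<^sub>R (D *v u'))
      = (- 1 / 3) *\<^sub>R ((matrix_inv M ** transpose D ** outer e_L e_L) *v (H\<^sup>2 *\<^sub>R u'))
        + (- 1 / 3) *\<^sub>R ((matrix_inv M ** outer e_L e_L ** matrix_inv M ** outer e_L e_L) *v (H\<^sup>2 *\<^sub>R u'))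
        + (- 1 / 2) *\<^sub>R ((matrix_inv M ** outer e_L e_L) *v (U *\<^sub>R u))
        + (- 1 / 6) *\<^sub>R ((matrix_inv M ** transpose D ** outer e_L e_L) *v ((H\<^sup>2 * U) *\<^sub>R (D *v u)))
        + (1 / 3) *\<^sub>R ((matrix_inv M ** (transpose D ** transpose D) ** outer e_L e_L) *v ((H\<^sup>2 * U) *\<^sub>R u))"
  shows "g * (h \<bullet> (M *v h')) + H * (u \<bullet> (M *v u'))
      + H ^ 3 / 3 * (((D + matrix_inv M ** outer e_L e_L) *v u)
          \<bullet> (M *v ((D + matrix_inv M ** outer e_L e_L) *v u')))
    = boundary_term g H U D h u u' $ right_ix"
proof -
  let ?W = "matrix_inv M" and ?l = "left_ix :: 'n" and ?r = "right_ix :: 'n"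
  have MW: "M *v (?W *v x) = x" for x
    using matrix_mult_matrix_inv[OF inv] by (simp add: matrix_vector_mul_assoc)
  have neg: "A *v (- x) = - (A *v x)" for A :: "'n rmat" and x
    by (simp add: vec_eq_iff matrix_vector_mult_def sum_negf)
  \<comment> \<open>The corner entry of the inverse mass matrix. Its value is not computed: the
    \<open>\<sigma>0\<close> penalty and the square of the correction in the modified norm produce
    it with opposite signs.\<close>
  let ?m = "(?W *v e_L) $ ?l"
  note lin = matrix_vector_mul_assoc[symmetric] matrix_vector_right_distrib
    matrix_vector_mult_diff_distrib matrix_vector_mult_scaleR outer_mult_vec MW
    inner_add_right inner_diff_right inner_transpose_mult neg
  have hh: "h \<bullet> (M *v h') = - H * (h \<bullet> (M *v (D *v u))) - U * (h \<bullet> (M *v (D *v h)))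
      - U / 2 * (h $ ?l)\<^sup>2 - H * h $ ?l * u $ ?l"
    using arg_cong[OF h, of "\<lambda>z. h \<bullet> (M *v z)"]
    by (simp add: lin power2_eq_square field_simps del: transpose_matrix_vector)
  \<comment> \<open>Testing cancels the leading \<open>matrix_inv M\<close> of each penalty; each
    transposed \<open>D\<close> moves onto \<open>u\<close>, giving left-node values of its discrete
    derivatives.\<close>
  have uu: "u \<bullet> (M *v u') = - g * (u \<bullet> (M *v (D *v h))) - U * (u \<bullet> (M *v (D *v u)))
      + H\<^sup>2 * U / 3 * (u \<bullet> (M *v (D *v (D *v (D *v u))))) + H\<^sup>2 / 3 * (u \<bullet> (M *v (D *v (D *v u'))))
      - H\<^sup>2 / 3 * (D *v u) $ ?l * u' $ ?l - H\<^sup>2 / 3 * u $ ?l * ?m * u' $ ?l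
      - U / 2 * (u $ ?l)\<^sup>2 - H\<^sup>2 * U / 6 * ((D *v u) $ ?l)\<^sup>2
      + H\<^sup>2 * U / 3 * (D *v (D *v u)) $ ?l * u $ ?l"
    using arg_cong[OF u, of "\<lambda>z. u \<bullet> (M *v z)"]
    by (simp add: lin power2_eq_square field_simps del: transpose_matrix_vector)
  \<comment> \<open>Of the three left-node terms, the first cancels the \<open>\<gamma>0\<close>
    penalty, the second the left end of \<open>uDD\<close> below, and the third the
    \<open>\<sigma>0\<close> penalty.\<close>
  have ee: "((D + ?W ** outer e_L e_L) *v u) \<bullet> (M *v ((D + ?W ** outer e_L e_L) *v u'))
    = (D *v u) \<bullet> (M *v (D *v u')) + (D *v u) $ ?l * u' $ ?l + u $ ?l * (D *v u') $ ?l
      + u $ ?l * ?m * u' $ ?l"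
    by (simp add: lin matrix_vector_mult_add_rdistrib inner_add_left
        inner_symmetric_matrix[OF sym, of "?W *v _"] algebra_simps)
  \<comment> \<open>With equal arguments both summands of \<open>sbp\<close> coincide, which
    produces the halves matched by \<open>\<tau>0\<close>, \<open>\<eta>0\<close> and
    \<open>\<mu>0\<close>.\<close>
  have hD: "h \<bullet> (M *v (D *v h)) = (h $ ?r)\<^sup>2 / 2 - (h $ ?l)\<^sup>2 / 2"
    and uD: "u \<bullet> (M *v (D *v u)) = (u $ ?r)\<^sup>2 / 2 - (u $ ?l)\<^sup>2 / 2"
    and DuD: "(D *v u) \<bullet> (M *v (D *v (D *v u))) = ((D *v u) $ ?r)\<^sup>2 / 2 - ((D *v u) $ ?l)\<^sup>2 / 2"
    using sbp[of h h] sbp[of u u] sbp[of "D *v u" "D *v u"]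
    by (simp_all add: inner_symmetric_matrix[OF sym] power2_eq_square)
  \<comment> \<open>The left ends of \<open>uDDD\<close> and \<open>hDu\<close> are removed by
    \<open>\<rho>0\<close> and \<open>\<theta>0\<close>. The volume term of \<open>uDD\<close>
    cancels that of \<open>ee\<close>, and the one of \<open>hDu\<close> cancels the gravity term of
    \<open>uu\<close>.\<close>
  have uDDD: "u \<bullet> (M *v (D *v (D *v (D *v u)))) = u $ ?r * (D *v (D *v u)) $ ?r
      - u $ ?l * (D *v (D *v u)) $ ?l - (D *v u) \<bullet> (M *v (D *v (D *v u)))"
    and uDD: "u \<bullet> (M *v (D *v (D *v u'))) = u $ ?r * (D *v u') $ ?r
      - u $ ?l * (D *v u') $ ?l - (D *v u) \<bullet> (M *v (D *v u'))"
    and hDu: "h \<bullet> (M *v (D *v u)) = h $ ?r * u $ ?r - h $ ?l * u $ ?l - u \<bullet> (M *v (D *v h))"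
    using sbp[of u "D *v (D *v u)"] sbp[of u "D *v u'"] sbp[of h u]
    by (simp_all add: inner_symmetric_matrix[OF sym])
  show ?thesis
    unfolding hh uu ee uDDD uDD hDu hD uD DuD boundary_term_def
    by (simp add: matrix_vector_mul_assoc[symmetric] power2_eq_square power3_eq_cube field_simps)
qed

theorem theorem9:
  fixes g H U \<Delta>x :: real and P :: nat
    and \<xi> \<omega> :: "'n::{finite,linorder} \<Rightarrow> real"
    and M D :: "'n rmat"
    and h u h' u' :: "real \<Rightarrow> 'n rvec"
    and \<tau>0 \<theta>0 \<gamma>0 \<sigma>0 \<eta>0 \<mu>0 \<rho>0 :: real
  assumes "g > 0" "H > 0" "U > 0" "P \<ge> 1" "\<Delta>x > 0"
    and "gauss_lobatto P \<xi> \<omega>"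
    and "M = mass_mat_x \<Delta>x \<omega>"
    and "D = diff_mat_x \<Delta>x \<xi> \<omega>"
    and "\<And>t. t \<ge> 0 \<Longrightarrow> (h has_vector_derivative h' t) (at t within {0..})"
    and "\<And>t. t \<ge> 0 \<Longrightarrow> (u has_vector_derivative u' t) (at t within {0..})"
    and "continuous_on {0..} h'" "continuous_on {0..} u'"
    and "\<And>t. t \<ge> 0 \<Longrightarrow>
      h' t + D *v (H *\<^sub>R u t + U *\<^sub>R h t)
      = \<tau>0 *\<^sub>R ((matrix_inv M ** outer e_L e_L) *v (U *\<^sub>R h t))
        + \<theta>0 *\<^sub>R ((matrix_inv M ** outer e_L e_L) *v (H *\<^sub>R u t))"
    and "\<And>t. t \<ge> 0 \<Longrightarrow>
      u' t + D *v (g *\<^sub>R h t + U *\<^sub>R u t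
                   - (H\<^sup>2 * U / 3) *\<^sub>R ((D ** D) *v u t) - (H\<^sup>2 / 3) *\<^sub>R (D *v u' t))
      = \<gamma>0 *\<^sub>R ((matrix_inv M ** transpose D ** outer e_L e_L) *v (H\<^sup>2 *\<^sub>R u' t))
        + \<sigma>0 *\<^sub>R ((matrix_inv M ** outer e_L e_L ** matrix_inv M ** outer e_L e_L) *v (H\<^sup>2 *\<^sub>R u' t))
        + \<eta>0 *\<^sub>R ((matrix_inv M ** outer e_L e_L) *v (U *\<^sub>R u t))
        + \<mu>0 *\<^sub>R ((matrix_inv M ** transpose D ** outer e_L e_L) *v ((H\<^sup>2 * U) *\<^sub>R (D *v u t)))
        + \<rho>0 *\<^sub>R ((matrix_inv M ** (transpose D ** transpose D) ** outer e_L e_L) *v ((H\<^sup>2 * U) *\<^sub>R u t))"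
    and "\<tau>0 = - 1 / 2" "\<eta>0 = - 1 / 2" "\<theta>0 = - 1"
    and "\<rho>0 = 1 / 3" "\<gamma>0 = - 1 / 3" "\<sigma>0 = - 1 / 3" "\<mu>0 = - 1 / 6"
    and "\<And>t. t \<ge> 0 \<Longrightarrow> boundary_term g H U D (h t) (u t) (u' t) $ right_ix = 0"
  shows "\<forall>t\<ge>0. energy g H M D (h t) (u t) = energy g H M D (h 0) (u 0)"
proof -
  let ?E = "\<lambda>t. energy g H M D (h t) (u t)" and ?T = "D + matrix_inv M ** outer e_L e_L"
  have pos: "\<forall>i. \<omega> i > 0"
    using assms(6) by (simp add: gauss_lobatto_def)
  have sym: "transpose M = M" and inv: "invertible M"
    using transpose_mass_mat_x invertible_mass_mat_x[OF pos assms(5)] by (simp_all add: assms(7))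
  have "(?E has_real_derivative 0) (at t within {0..})" if "t \<in> {0..}" for t
  proof -
    have t: "t \<ge> 0"
      using that by simp
    have T: "((\<lambda>t. ?T *v u t) has_vector_derivative ?T *v u' t) (at t within {0..})"
      by (intro bounded_linear.has_vector_derivative[OF _ assms(10)[OF t]]
          matrix_vector_mul_bounded_linear)
    have "(?E has_real_derivative g / 2 * (2 * (h t \<bullet> (M *v h' t)))
        + H / 2 * (2 * (u t \<bullet> (M *v u' t))) + H ^ 3 / 6 * (2 * ((?T *v u t) \<bullet> (M *v (?T *v u' t)))))
        (at t within {0..})"
      unfolding energy_def
      by (intro DERIV_add DERIV_cmult norm_sq_has_real_derivative sym assms(9,10) t T)
    moreover have "g * (h t \<bullet> (M *v h' t)) + H * (u t \<bullet> (M *v u' t))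
        + H ^ 3 / 3 * ((?T *v u t) \<bullet> (M *v (?T *v u' t))) = 0"
      \<comment> \<open>The absence of right-end contributions enters here: zero is rewritten as the
        boundary term at \<open>right_ix\<close>, the value that \<open>energy_rate\<close>
        yields.\<close>
      unfolding assms(22)[OF t, symmetric]
      using assms(13,14)[OF t] summation_by_parts[OF assms(6,5)]
      by (intro energy_rate[OF sym inv]) (simp_all only: assms(7,8,15-21))
    ultimately show ?thesis
      by simp
  qed
  \<comment> \<open>The half-line is convex, so a zero derivative within it (one-sided at 0) forces
    a constant.\<close>
  then obtain c where "\<And>t. t \<in> {0..} \<Longrightarrow> ?E t = c"
    using has_field_derivative_zero_constant[of "{0..}" ?E] by (auto simp: convex_real_interval)
  then show ?thesis
    by simp
qed

end
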